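(* Let $p$ be a prime and let $\alpha\in[0,1)$ be such that its base $p$ digit sequence is the concatenation $\mathcal{A}_1\mathcal{A}_2\mathcal{A}_3\cdots$, where for each $m\in\mathbb{N}$, $\mathcal{A}_m$ is the $p$-ary word of length $p^mp^{p^m}$ obtained by concatenating, for $n=0,1,\ldots,p^{p^m}-1$, the blocks $d_0(n)d_1(n)\cdots d_{p^m-1}(n)$, where, writing $n=\sum_{i=0}^{p^m-1}e_i(n)p^i$ with $e_i(n)\in\{0,\ldots,p-1\}$, the digit $d_k(n)\in\{0,\ldots,p-1\}$ is given by $d_k(n)\equiv\sum_{j=0}^{p^m-1}\binom{k+j}{j}e_j(n)\pmod p$. Then there is a constant $c_p>0$ depending only on $p$ such that the star discrepancy $D_N^*$ of $(\{p^n\alpha\})_{n=0,1,\ldots}$ satisfies $N D_N^*\ge c_p(\log N)^2$ for infinitely many $N$.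
   Context: $\{x\}$ denotes the fractional part of $x$. For a sequence $(x_n)_{n\ge0}$ in $[0,1)$, $D_N^*=\sup_{0<c\le1}\left|\frac1N\#\{0\le n<N:x_n\in[0,c)\}-c\right|$. (This $\alpha$ is Levin's normal number in base $p$, i.e. the concatenation of affine necklaces with parameters $\boldsymbol{z}=\boldsymbol{\eta}=\boldsymbol{0}$, $\boldsymbol{u}=\boldsymbol{1}$.) *)

theory Defs
  imports Complex_Main "HOL-Library.Stream" "HOL-Computational_Algebra.Primes"
begin

definition star_discrepancy :: "(nat \<Rightarrow> real) \<Rightarrow> nat \<Rightarrow> real" where
  "star_discrepancy x N =
     (SUP c\<in>{0<..1}. \<bar>real (card {n. n < N \<and> x n \<in> {0..<c}}) / real N - c\<bar>)"

text \<open>The digits of the base \<open>p\<close> expansion after the point, indexed from \<open>0\<close>. The floor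
  selects the expansion that is not eventually constant \<open>p - 1\<close>.\<close>

definition base_digit :: "nat \<Rightarrow> real \<Rightarrow> nat \<Rightarrow> nat" where
  "base_digit p \<alpha> i = nat \<lfloor>real p ^ Suc i * \<alpha>\<rfloor> mod p"

text \<open>Below, \<open>n div p ^ j mod p\<close> is the base \<open>p\<close> digit \<open>e\<^sub>j(n)\<close>.\<close>

definition levin_digit :: "nat \<Rightarrow> nat \<Rightarrow> nat \<Rightarrow> nat \<Rightarrow> nat" where
  "levin_digit p m n k =
     (\<Sum>j<p ^ m. ((k + j) choose j) * (n div p ^ j mod p)) mod p"

definition levin_block :: "nat \<Rightarrow> nat \<Rightarrow> nat \<Rightarrow> nat list" where
  "levin_block p m n = map (levin_digit p m n) [0..<p ^ m]"

definition levin_word :: "nat \<Rightarrow> nat \<Rightarrow> nat list" where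
  "levin_word p m = concat (map (levin_block p m) [0..<p ^ (p ^ m)])"

text \<open>The words are concatenated from \<open>m = 1\<close> on; they are nonempty for \<open>p > 0\<close>, as \<^const>\<open>flat\<close>
  requires.\<close>

definition levin_sequence :: "nat \<Rightarrow> nat stream" where
  "levin_sequence p = flat (smap (levin_word p) (fromN 1))"

end

(* Write q = p^m. A window of s <= q digits starting at offset k of the block of n determines, within
   an aligned interval of p^s consecutive n, at most one n: the a-th difference in k of
   binomial (k + j) j is binomial (k + j) (j - a), so differencing the digits triangularises the
   system, and modulo p the binomials are q-periodic in k, which covers windows straddling two blocks.
   Hence an elementary interval of length p^(-s) is hit at offset k at most once per aligned interval,
   and the deviation for n < M is decided by the incomplete last interval.

   Take M = 1 + p^p + p^(2p) + ..., truncated to q digits; by Lucas its block starts with q - p zeros.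
   Let c have the digits 0, 1, 0, ..., 0, 0, 1, 0, ... (period p). The elementary intervals composing
   [0, c) have length p^(-s) with s = p i + 2. If i > 0, the (s-1)-st difference of their prefix is -1,
   so a point of the incomplete interval would have digit number s - 1 equal to p - 1, while that of M
   is 0, whence n > M; if i = 0, the prefix is 0, whence n = M. The incomplete interval thus contributes
   no point and the deviation is at most -p^(-2), simultaneously for almost all offsets k. Letting s run
   up to a small multiple of q, with the trivial bound 1 at the remaining offsets, gives a deficit of
   order q^2 on the window from the start of the m-th word up to its block M, so one of the two
   endpoints N of this window is as required, and log N = O(q). *)

theory Submission
  imports Defs "HOL-Number_Theory.Cong" "HOL-Library.Infinite_Set"
begin

subsection \<open>Binomial coefficients modulo a prime power\<close>

text \<open>If \<open>p\<close> did not divide the coefficient, the absorption identity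
  \<open>i * (p ^ m choose i) = p ^ m * ((p ^ m - 1) choose (i - 1))\<close> would force
  \<open>p ^ m\<close> to divide \<open>i\<close>.\<close>

lemma prime_dvd_prime_power_choose:
  fixes p :: nat
  assumes "prime p" "0 < i" "i < p ^ m"
  shows "p dvd (p ^ m choose i)"
proof (rule ccontr)
  assume "\<not> p dvd (p ^ m choose i)"
  hence "coprime (p ^ m) (p ^ m choose i)"
    using assms(1) by (simp add: prime_imp_coprime)
  moreover have "i * (p ^ m choose i) = p ^ m * ((p ^ m - 1) choose (i - 1))"
    using times_binomial_minus1_eq[OF assms(2)] by simp
  ultimately have "p ^ m dvd i"
    by (metis coprime_dvd_mult_left_iff dvd_triv_left)
  with assms show False by (simp add: nat_dvd_not_less)
qed

text \<open>Coefficient form of (1 + X)^(P + K) = (1 + X^P) (1 + X)^K modulo \<open>p\<close>,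
  obtained from Pascal's rule by induction on \<open>K\<close>.\<close>

lemma prime_power_add_choose_cong:
  fixes p m :: nat
  assumes "prime p"
  defines "P \<equiv> p ^ m"
  shows "[((P + K) choose j) = (K choose j) + (if P \<le> j then K choose (j - P) else 0)] (mod p)"
proof (induction K arbitrary: j)
  case 0
  have P: "P > 0" using assms by (simp add: prime_gt_0_nat)
  consider "j = 0" | "0 < j" "j < P" | "j = P" | "j > P" by linarith
  thus ?case
  proof cases
    case 2
    thus ?thesis using prime_dvd_prime_power_choose[OF assms(1), of j m]
      by (simp add: P_def cong_0_iff binomial_eq_0)
  qed (use P in \<open>auto simp: binomial_eq_0\<close>)
next
  case (Suc K)
  show ?case
  proof (cases j)
    case 0
    have "P > 0" using assms by (simp add: prime_gt_0_nat)
    thus ?thesis using 0 by simp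
  next
    case (Suc l)
    have P: "P > 0" using assms by (simp add: prime_gt_0_nat)
    show ?thesis using cong_add[OF Suc.IH[of l] Suc.IH[of "Suc l"]] P Suc
      by (cases "P \<le> l"; cases "P = Suc l") (simp_all add: Suc_diff_le algebra_simps)
  qed
qed

lemma prime_power_add_choose_less_cong:
  fixes p :: nat
  assumes "prime p" "j < p ^ m"
  shows "[((p ^ m + K) choose j) = (K choose j)] (mod p)"
  using prime_power_add_choose_cong[OF assms(1), of m K j] assms(2) by simp

text \<open>The case of Lucas' theorem with last lower digit 0: raising \<open>a\<close> by one adds
  \<open>p\<close> to the upper index, and the preceding congruence with exponent 1 then acts as
  Pascal's rule in \<open>a\<close> and \<open>c\<close>.\<close>

lemma lucas_choose_mult_cong:
  fixes p :: nat
  assumes "prime p" "b < p"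
  shows "[((p * a + b) choose (p * c)) = (a choose c)] (mod p)"
proof (induction a arbitrary: c)
  case 0
  show ?case
  proof (cases c)
    case (Suc d)
    hence "b < p * c" using assms by simp
    thus ?thesis using Suc by (simp add: binomial_eq_0)
  qed simp
next
  case (Suc a)
  show ?case
  proof (cases c)
    case (Suc d)
    have "[((p + (p * a + b)) choose (p * c)) =
        ((p * a + b) choose (p * c)) + ((p * a + b) choose (p * d))] (mod p)"
      using prime_power_add_choose_cong[OF assms(1), of 1 "p * a + b" "p * c"] Suc by simp
    also have "[((p * a + b) choose (p * c)) + ((p * a + b) choose (p * d)) =
        (a choose c) + (a choose d)] (mod p)"
      by (intro cong_add Suc.IH)
    finally show ?thesis using Suc by (simp add: algebra_simps)
  qed simp
qed

text \<open>Since \<open>p\<close> divides \<open>p ^ m choose Suc r\<close>, Pascal's rule makes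
  neighbouring entries of row \<open>p ^ m - 1\<close> negatives of each other modulo
  \<open>p\<close>; the first entry is 1.\<close>

lemma prime_not_dvd_choose_pred_power:
  fixes p :: nat
  assumes "prime p" "r < p ^ m"
  shows "\<not> p dvd ((p ^ m - 1) choose r)"
  using assms(2)
proof (induction r)
  case 0
  thus ?case using assms(1) by (auto simp: prime_gt_1_nat not_prime_1)
next
  case (Suc r)
  have "(p ^ m choose Suc r) = ((p ^ m - 1) choose r) + ((p ^ m - 1) choose Suc r)"
    using Suc.prems by (metis Suc_pred' binomial_Suc_Suc gr_implies_not0 not_gr_zero)
  moreover have "p dvd (p ^ m choose Suc r)"
    using prime_dvd_prime_power_choose[OF assms(1)] Suc.prems by simp
  ultimately show ?case using Suc by (metis Suc_lessD dvd_add_left_iff)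
qed

subsection \<open>Finite differences of the Pascal matrix\<close>

definition fdiff :: "(nat \<Rightarrow> int) \<Rightarrow> nat \<Rightarrow> int" where
  "fdiff f k = f (Suc k) - f k"

text \<open>The digit formula before reduction modulo \<open>p\<close>, with integer input so that
  differences of digit vectors can be inserted.\<close>

definition pascal_map :: "nat \<Rightarrow> (nat \<Rightarrow> int) \<Rightarrow> nat \<Rightarrow> int" where
  "pascal_map q v k = (\<Sum>j<q. int ((k + j) choose j) * v j)"

lemma funpow_fdiff_Suc: "(fdiff ^^ Suc a) f k = (fdiff ^^ a) f (Suc k) - (fdiff ^^ a) f k"
  by (simp add: fdiff_def)

lemma funpow_fdiff_cong:
  assumes "\<And>i. i \<le> a \<Longrightarrow> [f (k + i) = g (k + i)] (mod p)"
  shows "[(fdiff ^^ a) f k = (fdiff ^^ a) g k] (mod p)"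
  using assms
proof (induction a arbitrary: k)
  case 0
  from 0[of 0] show ?case by simp
next
  case (Suc a)
  have "[(fdiff ^^ a) f (Suc k) = (fdiff ^^ a) g (Suc k)] (mod p)"
    by (rule Suc.IH) (use Suc.prems[of "Suc _"] in simp)
  moreover have "[(fdiff ^^ a) f k = (fdiff ^^ a) g k] (mod p)"
    by (rule Suc.IH) (use Suc.prems in simp)
  ultimately show ?case unfolding funpow_fdiff_Suc by (rule cong_diff)
qed

lemma funpow_fdiff_diff:
  "(fdiff ^^ a) (\<lambda>i. f i - g i) k = (fdiff ^^ a) f k - (fdiff ^^ a) g k"
  by (induction a arbitrary: k) (simp_all add: fdiff_def)

lemma funpow_fdiff_zero: "(fdiff ^^ a) (\<lambda>_. 0) k = 0"
  by (induction a arbitrary: k) (simp_all add: fdiff_def)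

lemma funpow_fdiff_last:
  assumes "\<And>i. i < a \<Longrightarrow> f (k + i) = 0"
  shows "(fdiff ^^ a) f k = f (k + a)"
  using assms
proof (induction a arbitrary: k)
  case (Suc a)
  have "(fdiff ^^ a) f (Suc k) = f (Suc k + a)"
    by (rule Suc.IH) (use Suc.prems[of "Suc _"] in simp)
  moreover have "(fdiff ^^ a) f k = f (k + a)"
    by (rule Suc.IH) (use Suc.prems in simp)
  ultimately show ?case unfolding funpow_fdiff_Suc using Suc.prems[of a] by simp
qed simp

lemma newton_forward:
  "f (k + a) = (\<Sum>i\<le>a. int (a choose i) * (fdiff ^^ i) f k)"
proof (induction a arbitrary: k)
  case (Suc a)
  let ?d = "\<lambda>i. (fdiff ^^ i) f k"
  have "f (k + Suc a) = (\<Sum>i\<le>a. int (a choose i) * (fdiff ^^ i) f (Suc k))"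
    using Suc[of "Suc k"] by simp
  also have "\<dots> = (\<Sum>i\<le>a. int (a choose i) * ?d i) + (\<Sum>i\<le>a. int (a choose i) * ?d (Suc i))"
    unfolding sum.distrib[symmetric]
    by (rule sum.cong) (simp_all add: fdiff_def algebra_simps)
  also have "(\<Sum>i\<le>a. int (a choose i) * ?d i) = (\<Sum>i\<le>Suc a. int (a choose i) * ?d i)"
    by simp
  also have "\<dots> = ?d 0 + (\<Sum>i\<le>a. int (a choose Suc i) * ?d (Suc i))"
    by (subst sum.atMost_Suc_shift) simp
  also have "\<dots> + (\<Sum>i\<le>a. int (a choose i) * ?d (Suc i)) =
      ?d 0 + (\<Sum>i\<le>a. int (Suc a choose Suc i) * ?d (Suc i))"
    by (simp add: sum.distrib[symmetric] algebra_simps)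
  also have "\<dots> = (\<Sum>i\<le>Suc a. int (Suc a choose i) * ?d i)"
    by (subst sum.atMost_Suc_shift) simp
  finally show ?case .
qed simp

text \<open>In Newton's formula for \<open>f (k + p)\<close> the coefficients
  \<open>p choose i\<close> with \<open>0 < i < p\<close> vanish modulo \<open>p\<close>, leaving
  only the two outer terms.\<close>

lemma funpow_fdiff_prime_cong:
  fixes p :: nat
  assumes "prime p"
  shows "[(fdiff ^^ p) f k = f (k + p) - f k] (mod int p)"
proof -
  have p: "p > 0" using assms by (simp add: prime_gt_0_nat)
  have "f (k + p) = (\<Sum>i\<in>insert 0 (insert p {0<..<p}). int (p choose i) * (fdiff ^^ i) f k)"
    unfolding newton_forward[of f k p] using p by (intro sum.cong) auto
  also have "\<dots> = f k + (fdiff ^^ p) f k + (\<Sum>i\<in>{0<..<p}. int (p choose i) * (fdiff ^^ i) f k)"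
    using p by simp
  finally have "f (k + p) - f k - (fdiff ^^ p) f k =
      (\<Sum>i\<in>{0<..<p}. int (p choose i) * (fdiff ^^ i) f k)" by simp
  moreover have "int p dvd \<dots>"
    using prime_dvd_prime_power_choose[OF assms, of _ 1] by (intro dvd_sum dvd_mult2) auto
  ultimately show ?thesis by (simp add: cong_iff_dvd_diff dvd_diff_commute algebra_simps)
qed

lemma funpow_fdiff_periodic_cong:
  fixes p :: nat
  assumes "prime p" "\<And>i. f (i + p) = f i" "p \<le> a"
  shows "[(fdiff ^^ a) f k = 0] (mod int p)"
proof -
  obtain b where b: "a = b + p" using assms(3) by (metis add.commute le_Suc_ex)
  have "[(fdiff ^^ b) ((fdiff ^^ p) f) k = (fdiff ^^ b) (\<lambda>_. 0) k] (mod int p)"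
    by (rule funpow_fdiff_cong) (use funpow_fdiff_prime_cong[OF assms(1), of f] assms(2) in simp)
  thus ?thesis unfolding b by (simp add: funpow_add funpow_fdiff_zero)
qed

text \<open>By Pascal's rule each difference in the row index lowers the lower binomial index by one
  and annihilates one more column; this is what triangularises the system.\<close>

lemma funpow_fdiff_pascal_map:
  "(fdiff ^^ a) (pascal_map q v) k =
     (\<Sum>j<q. (if a \<le> j then int ((k + j) choose (j - a)) else 0) * v j)"
proof (induction a arbitrary: k)
  case (Suc a)
  have *: "(if a \<le> j then int ((Suc k + j) choose (j - a)) else 0) -
      (if a \<le> j then int ((k + j) choose (j - a)) else 0) =
      (if Suc a \<le> j then int ((k + j) choose (j - Suc a)) else 0)" for j
  proof (cases "Suc a \<le> j")
    case True
    then obtain l where "j - a = Suc l" "j - Suc a = l"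
      by (metis Suc_diff_Suc Suc_le_lessD)
    thus ?thesis using True by simp
  qed (auto simp: not_less_eq_eq le_antisym)
  show ?case unfolding funpow_fdiff_Suc Suc.IH sum_subtractf[symmetric] left_diff_distrib[symmetric] *
    by simp
qed (simp add: pascal_map_def)

lemma funpow_fdiff_pascal_map_top:
  assumes "a < q" "\<And>j. a < j \<Longrightarrow> v j = 0"
  shows "(fdiff ^^ a) (pascal_map q v) k = v a"
proof -
  have "(fdiff ^^ a) (pascal_map q v) k = (\<Sum>j<q. if j = a then v a else 0)"
    unfolding funpow_fdiff_pascal_map by (intro sum.cong) (use assms(2) in \<open>auto simp: nat_less_le\<close>)
  thus ?thesis using assms(1) by simp
qed

lemma cong_0_small_imp_0:
  fixes x :: int
  assumes "[x = 0] (mod int p)" "\<bar>x\<bar> < int p"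
  shows "x = 0"
  using assms dvd_imp_le_int[of x "int p"] by (auto simp: cong_0_iff)

text \<open>The difference of order \<open>s - 1\<close> isolates the top entry
  \<open>v (s - 1)\<close>, which is therefore 0 modulo \<open>p\<close> and, being small, 0.
  Induction then shortens the window.\<close>

lemma pascal_map_window_inj:
  assumes "s \<le> q" "\<And>j. \<bar>v j\<bar> < int p" "\<And>j. s \<le> j \<Longrightarrow> v j = 0"
    and "\<And>i. i < s \<Longrightarrow> [pascal_map q v (k + i) = 0] (mod int p)"
  shows "v j = 0"
  using assms
proof (induction s)
  case (Suc s)
  have "[(fdiff ^^ s) (pascal_map q v) k = (fdiff ^^ s) (\<lambda>_. 0) k] (mod int p)"
    by (rule funpow_fdiff_cong) (use Suc.prems(4) in simp)
  hence "[v s = 0] (mod int p)"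
    using Suc.prems by (simp add: funpow_fdiff_pascal_map_top funpow_fdiff_zero)
  hence "v s = 0" using Suc.prems(2) by (rule cong_0_small_imp_0)
  thus ?case using Suc.prems by (intro Suc.IH) (auto simp: Suc_le_eq nat_less_le)
qed simp

text \<open>Only column indices below \<open>p ^ m\<close> occur, so adding \<open>p ^ m\<close> to
  the row changes no coefficient modulo \<open>p\<close>.\<close>

lemma pascal_map_periodic_cong:
  assumes "prime p"
  shows "[pascal_map (p ^ m) v (p ^ m + k) = pascal_map (p ^ m) v k] (mod int p)"
  unfolding pascal_map_def
  by (intro cong_sum cong_mult cong_refl)
    (use prime_power_add_choose_less_cong[OF assms] in
      \<open>auto simp: cong_int_iff add.assoc\<close>)

text \<open>The last rows are antitriangular modulo \<open>p\<close>: in row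
  \<open>p ^ m - Suc r\<close> the columns beyond \<open>r\<close> vanish, column \<open>r\<close>
  carries a unit, and the earlier entries are 0 by induction. Entries of \<open>v\<close> from index
  \<open>r\<close> on remain arbitrary.\<close>

lemma pascal_map_final_window_inj:
  assumes "prime p" "r \<le> p ^ m" "\<And>j. \<bar>v j\<bar> < int p"
    and "\<And>i. p ^ m - r \<le> i \<Longrightarrow> i < p ^ m \<Longrightarrow> [pascal_map (p ^ m) v i = 0] (mod int p)"
  shows "\<forall>j<r. v j = 0"
  using assms(2,4)
proof (induction r)
  case (Suc r)
  have IH: "v j = 0" if "j < r" for j using Suc that by auto
  let ?k = "p ^ m - Suc r"
  have *: "[int ((?k + j) choose j) * v j =
      (if j = r then int ((p ^ m - 1) choose r) * v r else 0)] (mod int p)"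
    if "j < p ^ m" for j
  proof -
    consider "j < r" | "j = r" | "j > r" by linarith
    thus ?thesis
    proof cases
      case 3
      have "?k + j = p ^ m + (j - Suc r)" using 3 Suc.prems(1) by simp
      hence "[((?k + j) choose j) = (j - Suc r) choose j] (mod p)"
        using prime_power_add_choose_less_cong[OF assms(1) that] by simp
      hence "[int ((?k + j) choose j) = 0] (mod int p)"
        using 3 by (simp add: binomial_eq_0 flip: cong_int_iff)
      hence "[int ((?k + j) choose j) * v j = 0 * v j] (mod int p)"
        by (rule cong_mult) simp
      thus ?thesis using 3 by simp
    qed (use IH Suc.prems(1) in auto)
  qed
  have "[pascal_map (p ^ m) v ?k =
      (\<Sum>j<p ^ m. if j = r then int ((p ^ m - 1) choose r) * v r else 0)] (mod int p)"
    unfolding pascal_map_def by (intro cong_sum *) simp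
  moreover have "[pascal_map (p ^ m) v ?k = 0] (mod int p)"
    using Suc.prems by simp
  ultimately have "int p dvd int ((p ^ m - 1) choose r) * v r"
    using Suc.prems(1) by (simp add: cong_def dvd_eq_mod_eq_0)
  moreover have "\<not> int p dvd int ((p ^ m - 1) choose r)"
    using prime_not_dvd_choose_pred_power[OF assms(1), of r m] Suc.prems(1) by simp
  ultimately have "int p dvd v r"
    using assms(1) by (metis prime_dvd_mult_iff prime_int_nat_transfer prime_nat_int_transfer)
  hence "v r = 0" using assms(3) by (intro cong_0_small_imp_0) (auto simp: cong_0_iff)
  with IH show ?case by (simp add: less_Suc_eq)
qed simp

subsection \<open>Windows of digits\<close>

lemma mod_power_Suc_eq:
  fixes n p :: nat
  shows "n mod p ^ Suc r = p ^ r * (n div p ^ r mod p) + n mod p ^ r"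
  using mod_mult2_eq[of n "p ^ r" p] by (simp add: mult.commute)

lemma mod_power_eqI:
  fixes n p :: nat
  assumes "\<And>j. j < r \<Longrightarrow> n div p ^ j mod p = n' div p ^ j mod p"
  shows "n mod p ^ r = n' mod p ^ r"
  using assms by (induction r) (simp_all add: mod_power_Suc_eq del: power_Suc)

lemma digit_eq_of_mod_eq:
  fixes n p :: nat
  assumes "n mod p ^ r = n' mod p ^ r" "j < r"
  shows "n div p ^ j mod p = n' div p ^ j mod p"
proof (cases "p = 0")
  case False
  have "n mod p ^ Suc j = n' mod p ^ Suc j"
    using assms mod_mod_cancel[OF le_imp_power_dvd[of "Suc j" r p]] by (metis Suc_leI)
  moreover have "n div p ^ j mod p = n mod p ^ Suc j div p ^ j" for n
    unfolding mod_power_Suc_eq using False by simp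
  ultimately show ?thesis by simp
qed (use assms in \<open>cases j; cases r; simp\<close>)

lemma digit_eq_of_div_eq:
  fixes n p :: nat
  assumes "n div p ^ s = n' div p ^ s" "s \<le> j"
  shows "n div p ^ j mod p = n' div p ^ j mod p"
proof -
  have "p ^ j = p ^ s * p ^ (j - s)" using assms(2) by (simp add: power_add[symmetric])
  thus ?thesis using assms(1) by (simp add: div_mult2_eq)
qed

lemma eq_of_digits_eq:
  fixes n p :: nat
  assumes "n div p ^ s = n' div p ^ s"
    and "\<And>j. j < s \<Longrightarrow> n div p ^ j mod p = n' div p ^ j mod p"
  shows "n = n'"
  using mod_power_eqI[OF assms(2)] assms(1) by (metis div_mult_mod_eq)

lemma less_of_digit_less:
  fixes n p :: nat
  assumes "n div p ^ Suc a = n' div p ^ Suc a" "n div p ^ a mod p < n' div p ^ a mod p"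
  shows "n < n'"
proof -
  have *: "n div p ^ a = p * (n div p ^ Suc a) + n div p ^ a mod p" for n
    by (simp add: div_mult2_eq power_Suc2 del: power_Suc)
  have "n div p ^ a < n' div p ^ a" using *[of n] *[of n'] assms by simp
  thus ?thesis by (meson div_le_mono leD leI)
qed

definition digit_diff :: "nat \<Rightarrow> nat \<Rightarrow> nat \<Rightarrow> nat \<Rightarrow> int" where
  "digit_diff p n n' j = int (n div p ^ j mod p) - int (n' div p ^ j mod p)"

lemma abs_digit_diff_less: "p > 0 \<Longrightarrow> \<bar>digit_diff p n n' j\<bar> < int p"
  unfolding digit_diff_def using mod_less_divisor[of p "n div p ^ j"]
    mod_less_divisor[of p "n' div p ^ j"] by linarith

lemma levin_digit_cong:
  "[int (levin_digit p m n k) = pascal_map (p ^ m) (\<lambda>j. int (n div p ^ j mod p)) k] (mod int p)"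
  unfolding levin_digit_def pascal_map_def by (simp add: zmod_int)

lemma pascal_map_digit_diff_cong:
  "[pascal_map (p ^ m) (digit_diff p n n') k = int (levin_digit p m n k) - int (levin_digit p m n' k)] (mod int p)"
proof -
  have "pascal_map (p ^ m) (digit_diff p n n') k =
      pascal_map (p ^ m) (\<lambda>j. int (n div p ^ j mod p)) k - pascal_map (p ^ m) (\<lambda>j. int (n' div p ^ j mod p)) k"
    by (simp add: pascal_map_def digit_diff_def right_diff_distrib sum_subtractf)
  thus ?thesis using cong_diff[OF levin_digit_cong levin_digit_cong] cong_sym by metis
qed

text \<open>By linearity the digit differences solve the homogeneous system on the window, and lying
  in one aligned interval makes them vanish from index \<open>s\<close> on.\<close>

lemma levin_digit_window_inj:
  assumes "prime p" "s \<le> p ^ m" "n div p ^ s = n' div p ^ s"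
    and "\<And>i. i < s \<Longrightarrow> levin_digit p m n (k + i) = levin_digit p m n' (k + i)"
  shows "n = n'"
proof (rule eq_of_digits_eq[OF assms(3)])
  fix j
  have "digit_diff p n n' j = 0"
  proof (rule pascal_map_window_inj[where q = "p ^ m" and p = p and k = k])
    show "[pascal_map (p ^ m) (digit_diff p n n') (k + i) = 0] (mod int p)" if "i < s" for i
      using pascal_map_digit_diff_cong[of p m n n' "k + i"] assms(4)[OF that] by simp
    show "digit_diff p n n' j = 0" if "s \<le> j" for j
      using digit_eq_of_div_eq[OF assms(3) that] by (simp add: digit_diff_def)
  qed (use assms abs_digit_diff_less in \<open>auto simp: prime_gt_0_nat\<close>)
  thus "n div p ^ j mod p = n' div p ^ j mod p" by (simp add: digit_diff_def)
qed

lemma levin_digit_final_window_inj: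
  assumes "prime p" "r \<le> p ^ m"
    and "\<And>i. p ^ m - r \<le> i \<Longrightarrow> i < p ^ m \<Longrightarrow> levin_digit p m n i = levin_digit p m n' i"
  shows "n mod p ^ r = n' mod p ^ r"
proof (rule mod_power_eqI)
  fix j assume "j < r"
  have "\<forall>j<r. digit_diff p n n' j = 0"
  proof (rule pascal_map_final_window_inj[OF assms(1,2)])
    show "[pascal_map (p ^ m) (digit_diff p n n') i = 0] (mod int p)"
      if "p ^ m - r \<le> i" "i < p ^ m" for i
      using pascal_map_digit_diff_cong[of p m n n' i] assms(3)[OF that] by simp
  qed (use assms abs_digit_diff_less in \<open>auto simp: prime_gt_0_nat\<close>)
  thus "n div p ^ j mod p = n' div p ^ j mod p" using \<open>j < r\<close> by (simp add: digit_diff_def)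
qed

text \<open>Converse use of the antitriangular shape: for a column \<open>j \<ge> r\<close> the
  upper index is \<open>p ^ m + l\<close> with \<open>l < j\<close>, so the coefficient reduces to
  \<open>l choose j = 0\<close>.\<close>

lemma pascal_map_final_rows_cong_0:
  assumes "prime p" "r \<le> p ^ m" "\<And>j. j < r \<Longrightarrow> v j = 0" "i < r"
  shows "[pascal_map (p ^ m) v (p ^ m - r + i) = 0] (mod int p)"
proof -
  have "[int ((p ^ m - r + i + j) choose j) * v j = 0] (mod int p)" if "j < p ^ m" for j
  proof (cases "j < r")
    case False
    define l where "l = i + j - r"
    have l: "p ^ m - r + i + j = p ^ m + l" "l < j"
      using False assms(2,4) by (auto simp: l_def)
    have "[((p ^ m + l) choose j) = l choose j] (mod p)"
      by (rule prime_power_add_choose_less_cong[OF assms(1) that])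
    hence "p dvd ((p ^ m + l) choose j)"
      using l(2) by (simp add: binomial_eq_0 cong_0_iff)
    hence "int p dvd int ((p ^ m + l) choose j) * v j" by simp
    thus ?thesis unfolding l(1) by (simp only: cong_0_iff)
  qed (use assms(3) in simp)
  hence "[pascal_map (p ^ m) v (p ^ m - r + i) = (\<Sum>j<p ^ m. 0)] (mod int p)"
    unfolding pascal_map_def by (intro cong_sum) simp
  thus ?thesis by simp
qed

text \<open>For a window straddling two consecutive blocks it is the second block index that has to be
  compared within an aligned interval, since passing from \<open>n\<close> to \<open>n + 1\<close> can carry into
  the digits beyond \<open>s\<close>.\<close>

lemma levin_digit_straddling_window_inj:
  assumes "prime p" "r + t \<le> p ^ m" "Suc n div p ^ (r + t) = Suc n' div p ^ (r + t)"
    and last: "\<And>i. p ^ m - r \<le> i \<Longrightarrow> i < p ^ m \<Longrightarrow> levin_digit p m n i = levin_digit p m n' i"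
    and first: "\<And>i. i < t \<Longrightarrow> levin_digit p m (Suc n) i = levin_digit p m (Suc n') i"
  shows "n = n'"
proof -
  let ?q = "p ^ m" and ?v = "digit_diff p (Suc n) (Suc n')"
  have "n mod p ^ r = n' mod p ^ r"
    by (rule levin_digit_final_window_inj) (use assms(1,2) last in auto)
  hence *: "Suc n mod p ^ r = Suc n' mod p ^ r" by (metis mod_Suc_eq)
  hence low: "?v j = 0" if "j < r" for j
    using digit_eq_of_mod_eq[OF * that] by (simp add: digit_diff_def)
  \<comment> \<open>The digits seen in the first block belong to \<open>n\<close>, not to
    \<open>Suc n\<close>. They serve only to make the lowest \<open>r\<close> entries of
    \<open>?v\<close> vanish, hence also its last \<open>r\<close> rows; by periodicity the first
    \<open>t\<close> rows continue these to one window of \<open>r + t\<close> rows.\<close>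
  have "?v j = 0" for j
  proof (rule pascal_map_window_inj[where q = ?q and p = p and k = "?q - r" and s = "r + t"])
    show "[pascal_map ?q ?v (?q - r + i) = 0] (mod int p)" if "i < r + t" for i
    proof (cases "i < r")
      case True
      thus ?thesis using pascal_map_final_rows_cong_0[OF assms(1) _ low] assms(2) by simp
    next
      case False
      define l where "l = i - r"
      have l: "?q - r + i = ?q + l" "l < t" using False assms(2) that by (auto simp: l_def)
      have "[pascal_map ?q ?v (?q + l) = pascal_map ?q ?v l] (mod int p)"
        by (rule pascal_map_periodic_cong[OF assms(1)])
      also have "[pascal_map ?q ?v l = 0] (mod int p)"
        using pascal_map_digit_diff_cong[of p m "Suc n" "Suc n'" l] first[OF l(2)] by simp
      finally show ?thesis unfolding l(1) .
    qed
    show "?v j = 0" if "r + t \<le> j" for j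
      using digit_eq_of_div_eq[OF assms(3) that] by (simp add: digit_diff_def)
  qed (use assms abs_digit_diff_less in \<open>auto simp: prime_gt_0_nat\<close>)
  hence "Suc n = Suc n'"
    by (intro eq_of_digits_eq[OF assms(3)]) (simp add: digit_diff_def)
  thus ?thesis by simp
qed

section \<open>Counting block indices with a prescribed window of digits\<close>

lemma card_le_by_div:
  assumes "\<And>n. n \<in> A \<Longrightarrow> f n < B" "\<And>n n'. n \<in> A \<Longrightarrow> n' \<in> A \<Longrightarrow> f n = f n' \<Longrightarrow> n = n'"
  shows "card A \<le> B"
proof -
  have "card A \<le> card {..<B}" by (rule card_inj_on_le[of f]) (use assms in \<open>auto intro: inj_onI\<close>)
  thus ?thesis by simp
qed

text \<open>The block of \<open>n\<close> continued into that of \<open>Suc n\<close>. Two blocks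
  suffice, since the windows considered start in the first and are at most one block long.\<close>

definition running_digit :: "nat \<Rightarrow> nat \<Rightarrow> nat \<Rightarrow> nat \<Rightarrow> nat" where
  "running_digit p m n i =
     (if i < p ^ m then levin_digit p m n i else levin_digit p m (Suc n) (i - p ^ m))"

text \<open>Each aligned interval of length \<open>p ^ s\<close> holds at most one solution. For
  straddling windows the interval of \<open>Suc n\<close> is used; as \<open>Suc n \<le> M\<close>,
  the same number of intervals is available.\<close>

lemma card_window_le:
  assumes "prime p" "s \<le> p ^ m" "k < p ^ m"
  shows "card {n. n < M \<and> (\<forall>i<s. running_digit p m n (k + i) = w i)} \<le> M div p ^ s + 1"
    (is "card ?A \<le> _")
proof (cases "k + s \<le> p ^ m")
  case True
  show ?thesis
  proof (rule card_le_by_div[where f = "\<lambda>n. n div p ^ s"])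
    fix n assume "n \<in> ?A"
    hence "n div p ^ s \<le> M div p ^ s" by (intro div_le_mono) simp
    thus "n div p ^ s < M div p ^ s + 1" by simp
  next
    fix n n' assume A: "n \<in> ?A" "n' \<in> ?A" "n div p ^ s = n' div p ^ s"
    show "n = n'"
    proof (rule levin_digit_window_inj[OF assms(1,2) A(3), of k])
      fix i assume i: "i < s"
      hence "running_digit p m n (k + i) = running_digit p m n' (k + i)" using A(1,2) by simp
      thus "levin_digit p m n (k + i) = levin_digit p m n' (k + i)"
        using i True by (simp add: running_digit_def)
    qed
  qed
next
  case False
  define r t where "r = p ^ m - k" and "t = s - r"
  have s: "s = r + t" and k: "p ^ m - r = k" "k + r = p ^ m"
    using False assms by (auto simp: r_def t_def)
  show ?thesis
  proof (rule card_le_by_div[where f = "\<lambda>n. Suc n div p ^ s"])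
    fix n assume "n \<in> ?A"
    hence "Suc n div p ^ s \<le> M div p ^ s" by (intro div_le_mono) (simp add: Suc_le_eq)
    thus "Suc n div p ^ s < M div p ^ s + 1" by simp
  next
    fix n n' assume A: "n \<in> ?A" "n' \<in> ?A" "Suc n div p ^ s = Suc n' div p ^ s"
    have eq: "running_digit p m n (k + i) = running_digit p m n' (k + i)" if "i < s" for i
      using A(1,2) that by simp
    show "n = n'"
    proof (rule levin_digit_straddling_window_inj[OF assms(1), of r t m])
      fix i assume i: "p ^ m - r \<le> i" "i < p ^ m"
      hence "i - k < s" "k + (i - k) = i" using k s by linarith+
      thus "levin_digit p m n i = levin_digit p m n' i"
        using eq[of "i - k"] i(2) by (simp add: running_digit_def)
    next
      fix i assume i: "i < t"
      hence ri: "r + i < s" "k + (r + i) = p ^ m + i" using k s by linarith+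
      show "levin_digit p m (Suc n) i = levin_digit p m (Suc n') i"
        using eq[OF ri(1)] unfolding ri(2) by (simp add: running_digit_def)
    qed (use A(3) s assms in auto)
  qed
qed

subsection \<open>Base expansions and the cut\<close>

text \<open>The most significant digit comes first, so that comparing values is comparing digits
  lexicographically.\<close>

primrec digits_value :: "nat \<Rightarrow> (nat \<Rightarrow> nat) \<Rightarrow> nat \<Rightarrow> nat" where
  "digits_value p b 0 = 0"
| "digits_value p b (Suc l) = p * digits_value p b l + b l"

lemma digits_value_eq_imp:
  assumes "\<And>i. b i < p" "\<And>i. c i < p" "digits_value p b h = digits_value p c h" "i < h"
  shows "b i = c i"
  using assms(3,4)
proof (induction h)
  case (Suc h)
  have "b h = (p * digits_value p b h + b h) mod p" "c h = (p * digits_value p c h + c h) mod p"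
    using assms(1,2) by simp_all
  hence "b h = c h" using Suc.prems(1) by (metis digits_value.simps(2))
  moreover have "p > 0" using assms(1)[of 0] by simp
  ultimately show ?case using Suc by (auto simp: less_Suc_eq)
qed simp

lemma digits_value_less_imp:
  assumes "\<And>i. b i < p" "\<And>i. c i < p" "digits_value p b h < digits_value p c h"
  shows "\<exists>l<h. b l < c l \<and> (\<forall>i<l. b i = c i)"
  using assms(3)
proof (induction h)
  case (Suc h)
  consider "digits_value p b h < digits_value p c h" | "digits_value p b h = digits_value p c h"
    | "digits_value p b h > digits_value p c h" by linarith
  thus ?case
  proof cases
    case 1
    thus ?thesis using Suc.IH less_SucI by blast
  next
    case 2
    hence "b h < c h" using Suc.prems by simp
    thus ?thesis using digits_value_eq_imp[OF assms(1,2) 2] by blast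
  next
    \<comment> \<open>Impossible: after multiplication by \<open>p\<close>, a prefix of
      \<open>b\<close> that is larger by at least 1 outweighs the last digit of
      \<open>c\<close>.\<close>
    case 3
    hence "p * Suc (digits_value p c h) \<le> p * digits_value p b h" by (intro mult_le_mono2) simp
    thus ?thesis using Suc.prems assms(2)[of h] by simp
  qed
qed simp

lemma digits_value_less_power:
  assumes "\<And>i. b i < p"
  shows "digits_value p b h < p ^ h"
proof (induction h)
  case (Suc h)
  hence "p * Suc (digits_value p b h) \<le> p * p ^ h" by (intro mult_le_mono2) simp
  thus ?case using assms[of h] by simp
qed simp

lemma digits_value_eq_sum:
  assumes "p > 0"
  shows "real (digits_value p b h) / real p ^ h = (\<Sum>i<h. real (b i) / real p ^ Suc i)"
proof (induction h)
  case (Suc h)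
  show ?case unfolding sum.lessThan_Suc Suc.IH[symmetric] using assms by (simp add: field_simps)
qed simp

text \<open>Dividing the floor for \<open>Suc l\<close> by \<open>p\<close> gives the floor for
  \<open>l\<close>. Its remainder is the digit at \<open>t + l\<close>, because removing the integer
  part of \<open>p ^ t * \<alpha>\<close> shifts it by a multiple of \<open>p\<close>.\<close>

lemma floor_power_mult_frac:
  assumes "p > 0" "0 \<le> \<alpha>"
  shows "\<lfloor>real p ^ l * frac (real p ^ t * \<alpha>)\<rfloor> =
     int (digits_value p (\<lambda>i. base_digit p \<alpha> (t + i)) l)"
proof (induction l)
  case 0
  show ?case by (simp add: floor_eq_iff frac_lt_1)
next
  case (Suc l)
  let ?x = "frac (real p ^ t * \<alpha>)"
  let ?y = "\<lfloor>real p ^ Suc l * ?x\<rfloor>"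
  have "?y div int p = \<lfloor>real p ^ Suc l * ?x / real_of_int (int p)\<rfloor>"
    by (rule floor_divide_real_eq_div[symmetric]) simp
  also have "real p ^ Suc l * ?x / real_of_int (int p) = real p ^ l * ?x"
    using assms(1) by simp
  finally have div: "?y div int p = int (digits_value p (\<lambda>i. base_digit p \<alpha> (t + i)) l)"
    unfolding Suc.IH .
  have "real p ^ Suc (t + l) * \<alpha> = real p ^ Suc l * ?x + of_int (int p ^ Suc l * \<lfloor>real p ^ t * \<alpha>\<rfloor>)"
    by (simp add: frac_def power_add algebra_simps)
  hence "\<lfloor>real p ^ Suc (t + l) * \<alpha>\<rfloor> = ?y + int p ^ Suc l * \<lfloor>real p ^ t * \<alpha>\<rfloor>"
    by (metis floor_add_int)
  hence "\<lfloor>real p ^ Suc (t + l) * \<alpha>\<rfloor> mod int p = ?y mod int p"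
    by (simp add: mult.assoc)
  moreover have "\<lfloor>real p ^ Suc (t + l) * \<alpha>\<rfloor> \<ge> 0" using assms by simp
  ultimately have mod: "?y mod int p = int (base_digit p \<alpha> (t + l))"
    by (simp add: base_digit_def zmod_int)
  have "?y = int p * (?y div int p) + ?y mod int p" by simp
  thus ?case unfolding div mod by simp
qed

lemma sum_residue_class:
  fixes f :: "nat \<Rightarrow> 'a::comm_semiring_1"
  assumes "e < p"
  shows "(\<Sum>l<p * g. of_bool (l mod p = e) * f l) = (\<Sum>i<g. f (p * i + e))"
proof -
  have "(\<Sum>l<p * g. of_bool (l mod p = e) * f l) = (\<Sum>l\<in>{l. l < p * g \<and> l mod p = e}. f l)"
    by (rule sum.mono_neutral_cong_right) auto
  also have "\<dots> = (\<Sum>i<g. f (p * i + e))"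
  proof (rule sum.reindex_bij_witness[where i = "\<lambda>i. p * i + e" and j = "\<lambda>l. l div p"])
    fix i assume "i \<in> {..<g}"
    hence "p * Suc i \<le> p * g" by (intro mult_le_mono2) simp
    thus "p * i + e \<in> {l. l < p * g \<and> l mod p = e}" using assms by simp
  next
    fix l assume l: "l \<in> {l. l < p * g \<and> l mod p = e}"
    thus "p * (l div p) + e = l" using mult_div_mod_eq[of p l] by simp
    thus "f (p * (l div p) + e) = f l" by simp
    show "l div p \<in> {..<g}" using l by (simp add: less_mult_imp_div_less mult.commute)
  qed (use assms in auto)
  finally show ?thesis .
qed

section \<open>Numbers with prescribed digits and the cut\<close>

lemma digit_sum_less:
  fixes p :: nat
  assumes "\<And>j. a j < p"
  shows "(\<Sum>j<J. a j * p ^ j) < p ^ J"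
proof (induction J)
  case (Suc J)
  have "Suc (a J) * p ^ J \<le> p * p ^ J" using assms[of J] by (intro mult_le_mono1) simp
  thus ?case using Suc by simp
qed simp

lemma digit_of_digit_sum:
  fixes p :: nat
  assumes "\<And>j. a j < p" "i < J"
  shows "(\<Sum>j<J. a j * p ^ j) div p ^ i mod p = a i"
  using assms(2)
proof (induction J)
  case (Suc J)
  have p: "p > 0" using assms(1)[of 0] by simp
  show ?case
  proof (cases "i = J")
    case True
    thus ?thesis using digit_sum_less[of a p J] assms(1) p by simp
  next
    case False
    hence i: "i < J" using Suc.prems by simp
    then obtain d where J: "J = i + Suc d" by (metis less_imp_Suc_add add_Suc_right)
    have *: "(\<Sum>j<Suc J. a j * p ^ j) = (\<Sum>j<J. a j * p ^ j) + p ^ i * (p * (p ^ d * a J))"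
      by (simp add: J power_add)
    show ?thesis unfolding * using Suc.IH[OF i] p by simp
  qed
qed simp

text \<open>Nonzero digits of the cut recur with period \<open>p\<close>, so that the digit block of the cut starts
  with zeros, while its remainders modulo powers of \<open>p\<close> are not close to a full period. The
  constant digit \<open>1\<close> would fail for \<open>p = 2\<close>.\<close>

definition levin_cut :: "nat \<Rightarrow> nat \<Rightarrow> nat" where
  "levin_cut p m = (\<Sum>j<p ^ m. of_bool (j mod p = 0) * p ^ j)"

lemma cut_less: "1 < p \<Longrightarrow> levin_cut p m < p ^ p ^ m"
  unfolding levin_cut_def by (rule digit_sum_less) simp

lemma digit_cut: "1 < p \<Longrightarrow> j < p ^ m \<Longrightarrow> levin_cut p m div p ^ j mod p = of_bool (j mod p = 0)"
  unfolding levin_cut_def by (rule digit_of_digit_sum) simp_all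

text \<open>With \<open>a = k div p\<close>, Lucas' congruence turns the sum over multiples of
  \<open>p\<close> into the sum of \<open>(a + j) choose j\<close> for \<open>j < p ^ m\<close>. The
  hockey-stick identity gives \<open>(p ^ m + a) choose (p ^ m - 1)\<close>, which reduces to
  \<open>a choose (p ^ m - 1)\<close>, and this is 0 because \<open>Suc a < p ^ m\<close>.\<close>

lemma levin_digit_cut:
  assumes "prime p" "k + p < p ^ Suc m"
  shows "levin_digit p (Suc m) (levin_cut p (Suc m)) k = 0"
proof -
  let ?Q = "p ^ m"
  have p: "1 < p" using assms(1) by (rule prime_gt_1_nat)
  define a b where "a = k div p" and "b = k mod p"
  have k: "k = p * a + b" and b: "b < p" using p by (simp_all add: a_def b_def)
  have "p * Suc a < p * ?Q" using assms(2) k by simp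
  hence a: "Suc a < ?Q" by (simp only: mult_less_cancel1)
  have "levin_digit p (Suc m) (levin_cut p (Suc m)) k =
      (\<Sum>j<p * ?Q. of_bool (j mod p = 0) * ((k + j) choose j)) mod p"
    unfolding levin_digit_def using digit_cut[OF p, of _ "Suc m"]
    by (intro arg_cong[where f = "\<lambda>x. x mod p"] sum.cong) simp_all
  also have "\<dots> = (\<Sum>j<?Q. (p * (a + j) + b) choose (p * j)) mod p"
    using sum_residue_class[of 0 p "\<lambda>j. (k + j) choose j" ?Q] p by (simp add: k algebra_simps)
  also have "\<dots> = (\<Sum>j<?Q. (a + j) choose j) mod p"
    unfolding cong_def[symmetric] by (intro cong_sum lucas_choose_mult_cong[OF assms(1) b])
  also have "(\<Sum>j<?Q. (a + j) choose j) = (?Q + a) choose (?Q - 1)"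
  proof -
    have "{..<?Q} = {..?Q - 1}" "Suc (a + (?Q - 1)) = ?Q + a" using a by auto
    thus ?thesis using sum_choose_lower[of a "?Q - 1"] by metis
  qed
  also have "\<dots> mod p = (a choose (?Q - 1)) mod p"
    using prime_power_add_choose_less_cong[OF assms(1), of "?Q - 1" m a] a by (simp add: cong_def)
  also have "a choose (?Q - 1) = 0" using a by (intro binomial_eq_0) simp
  finally show ?thesis by simp
qed

text \<open>The digits of the endpoint \<open>c\<close> up to one of its ones, which is lowered to \<open>0\<close>: these prefixes
  describe the elementary intervals that compose \<open>{0..<c}\<close>.\<close>

definition lowered_prefix :: "nat \<Rightarrow> nat \<Rightarrow> nat \<Rightarrow> nat" where
  "lowered_prefix p i l = of_bool (l mod p = 1 \<and> l \<noteq> p * i + 1)"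

text \<open>The prefix is a \<open>p\<close>-periodic pattern minus a spike at its last place. The
  order of the difference is at least \<open>p\<close> because \<open>0 < i\<close>, so the pattern
  disappears and the spike contributes -1.\<close>

lemma funpow_fdiff_lowered_prefix_cong:
  assumes "prime p" "0 < i"
    and f: "\<And>l. l < p * i + 2 \<Longrightarrow> [f (k + l) = int (lowered_prefix p i l)] (mod int p)"
  shows "[(fdiff ^^ (p * i + 1)) f k = - 1] (mod int p)"
proof -
  let ?a = "p * i + 1"
  define u :: "nat \<Rightarrow> int" where "u = (\<lambda>x. of_bool (x mod p = (k + 1) mod p))"
  define \<delta> :: "nat \<Rightarrow> int" where "\<delta> = (\<lambda>x. of_bool (x = k + ?a))"
  have p: "1 < p" using assms(1) by (rule prime_gt_1_nat)
  have "[(fdiff ^^ ?a) f k = (fdiff ^^ ?a) (\<lambda>x. u x - \<delta> x) k] (mod int p)"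
  proof (rule funpow_fdiff_cong)
    fix l assume "l \<le> ?a"
    moreover have "(k + l) mod p = (k + 1) mod p \<longleftrightarrow> l mod p = 1"
      using cong_add_lcancel_nat[of k l 1 p] p by (simp add: cong_def)
    hence "u (k + l) - \<delta> (k + l) = int (lowered_prefix p i l)"
      using p by (auto simp: u_def \<delta>_def lowered_prefix_def)
    ultimately show "[f (k + l) = u (k + l) - \<delta> (k + l)] (mod int p)"
      using f[of l] by simp
  qed
  also have "(fdiff ^^ ?a) (\<lambda>x. u x - \<delta> x) k = (fdiff ^^ ?a) u k - (fdiff ^^ ?a) \<delta> k"
    by (rule funpow_fdiff_diff)
  also have "(fdiff ^^ ?a) \<delta> k = 1"
    by (subst funpow_fdiff_last) (auto simp: \<delta>_def)
  also have "[(fdiff ^^ ?a) u k - 1 = 0 - 1] (mod int p)"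
  proof (intro cong_diff cong_refl funpow_fdiff_periodic_cong[OF assms(1)])
    have "p * 1 \<le> p * i" using assms(2) by (intro mult_le_mono2) simp
    thus "p \<le> ?a" by linarith
  qed (simp add: u_def)
  finally show ?thesis by simp
qed

text \<open>The gain of 1 over \<open>card_window_le\<close> comes from excluding the aligned
  interval that contains \<open>M\<close>. The bound on \<open>k\<close> keeps the window inside one
  block and inside the initial zeros of the block of \<open>M\<close>.\<close>

lemma card_window_cut_le:
  assumes "prime p" "k + (p * i + 2) + p \<le> p ^ Suc m"
  defines "M \<equiv> levin_cut p (Suc m)"
  shows "card {n. n < M \<and> (\<forall>l<p * i + 2. running_digit p (Suc m) n (k + l) = lowered_prefix p i l)}
           \<le> M div p ^ (p * i + 2)"
    (is "card ?A \<le> _")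
proof (rule card_le_by_div[where f = "\<lambda>n. n div p ^ (p * i + 2)"])
  let ?s = "p * i + 2" and ?a = "p * i + 1" and ?q = "p ^ Suc m"
  have p: "1 < p" using assms(1) by (rule prime_gt_1_nat)
  have digit: "levin_digit p (Suc m) n (k + l) = lowered_prefix p i l" if "n \<in> ?A" "l < ?s" for n l
  proof -
    have "running_digit p (Suc m) n (k + l) = lowered_prefix p i l" using that by blast
    moreover have "k + l < ?q" using that(2) assms(2) by linarith
    ultimately show ?thesis unfolding running_digit_def by metis
  qed
  show "n = n'" if "n \<in> ?A" "n' \<in> ?A" "n div p ^ ?s = n' div p ^ ?s" for n n'
    by (rule levin_digit_window_inj[OF assms(1) _ that(3), of "Suc m" k])
      (use digit[OF that(1)] digit[OF that(2)] assms(2) in auto)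
  fix n assume n: "n \<in> ?A"
  have "n < M" using n by blast
  have "n div p ^ ?s \<noteq> M div p ^ ?s"
  proof
    assume eq: "n div p ^ ?s = M div p ^ ?s"
    have M0: "levin_digit p (Suc m) M (k + l) = 0" if "l < ?s" for l
      unfolding M_def by (rule levin_digit_cut[OF assms(1)]) (use that assms(2) in linarith)
    show False
    proof (cases "i = 0")
      case True
      have "n = M"
      proof (rule levin_digit_window_inj[OF assms(1) _ eq, of "Suc m" k])
        fix l assume l: "l < ?s"
        hence "l = 0 \<or> l = 1" using True by auto
        hence "lowered_prefix p i l = 0" using True by (auto simp: lowered_prefix_def)
        thus "levin_digit p (Suc m) n (k + l) = levin_digit p (Suc m) M (k + l)"
          using digit[OF n l] M0[OF l] by simp
      qed (use assms(2) in simp)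
      thus False using \<open>n < M\<close> by simp
    next
      case False
      define v where "v = digit_diff p n M"
      have v: "v j = 0" if "?a < j" for j
        using digit_eq_of_div_eq[OF eq, of j] that by (simp add: v_def digit_diff_def)
      have a: "?a < ?q" using assms(2) by linarith
      have "(fdiff ^^ ?a) (pascal_map ?q v) k = v ?a"
        by (rule funpow_fdiff_pascal_map_top[OF a v])
      \<comment> \<open>The window of \<open>M\<close> is zero, so the image of the difference
        vector \<open>v\<close> is the prefix itself modulo \<open>p\<close>.\<close>
      moreover have "[(fdiff ^^ ?a) (pascal_map ?q v) k = - 1] (mod int p)"
      proof (rule funpow_fdiff_lowered_prefix_cong[OF assms(1)])
        fix l assume "l < ?s"
        thus "[pascal_map ?q v (k + l) = int (lowered_prefix p i l)] (mod int p)"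
          using pascal_map_digit_diff_cong[of p "Suc m" n M "k + l"] digit[OF n] M0
          unfolding v_def by simp
      qed (use False in simp)
      ultimately have "[v ?a = - 1] (mod int p)" by simp
      moreover have Ma: "M div p ^ ?a mod p = 0"
        using digit_cut[OF p a] p mod_mult_self4[of p i 1] unfolding M_def by simp
      ultimately have "[int (n div p ^ ?a mod p) = - 1] (mod int p)"
        by (simp add: v_def digit_diff_def)
      moreover have "\<not> [0 = - 1] (mod int p)" using p by (simp add: cong_iff_dvd_diff)
      ultimately have "n div p ^ ?a mod p \<noteq> 0" by (metis of_nat_0)
      hence "M < n" using less_of_digit_less[of M p ?a n] eq Ma by simp
      thus False using \<open>n < M\<close> by simp
    qed
  qed
  moreover have "n div p ^ ?s \<le> M div p ^ ?s" using \<open>n < M\<close> by (intro div_le_mono) simp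
  ultimately show "n div p ^ ?s < M div p ^ ?s" by linarith
qed

text \<open>The cut has digit 1 at place \<open>p * i\<close>, so its remainder modulo
  \<open>p ^ (p * i + 2)\<close> is at least \<open>p ^ (p * i)\<close>, a fraction
  \<open>1 / p ^ 2\<close> of the modulus.\<close>

lemma cut_div_le:
  assumes "1 < p" "p * i + 2 \<le> p ^ m"
  shows "real (levin_cut p m div p ^ (p * i + 2)) \<le> real (levin_cut p m) / real p ^ (p * i + 2) - 1 / real p ^ 2"
proof -
  let ?M = "levin_cut p m" and ?s = "p * i + 2"
  have "?M div p ^ (p * i) mod p = 1" using digit_cut[of p "p * i" m] assms by simp
  hence "p ^ (p * i) \<le> ?M mod p ^ Suc (p * i)" by (simp add: mod_power_Suc_eq del: power_Suc)
  also have "\<dots> = ?M mod p ^ ?s mod p ^ Suc (p * i)"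
    by (rule mod_mod_cancel[symmetric]) (simp add: le_imp_power_dvd del: power_Suc)
  also have "\<dots> \<le> ?M mod p ^ ?s" by simp
  finally have "real p ^ (p * i) \<le> real (?M mod p ^ ?s)" by (metis of_nat_le_iff of_nat_power)
  moreover have "real ?M = real (?M div p ^ ?s) * real p ^ ?s + real (?M mod p ^ ?s)"
    by (metis div_mult_mod_eq of_nat_add of_nat_mult of_nat_power)
  ultimately have "real (?M div p ^ ?s) * real p ^ ?s \<le> real ?M - real p ^ (p * i)" by simp
  hence "real (?M div p ^ ?s) \<le> (real ?M - real p ^ (p * i)) / real p ^ ?s"
    using assms(1) by (simp add: pos_le_divide_eq)
  also have "\<dots> = real ?M / real p ^ ?s - 1 / real p ^ 2"
    using assms(1) by (simp add: power_add field_simps power2_eq_square)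
  finally show ?thesis .
qed

subsection \<open>Positions in the sequence and the deviation\<close>

lemma length_concat_uniform:
  assumes "\<And>n. length (g n) = q"
  shows "length (concat (map g [0..<L])) = q * L"
  by (induction L) (simp_all add: assms)

lemma nth_concat_uniform:
  assumes "\<And>n. length (g n) = q" "n < L" "k < q"
  shows "concat (map g [0..<L]) ! (q * n + k) = g n ! k"
  using assms(2)
proof (induction L)
  case (Suc L)
  show ?case
  proof (cases "n = L")
    case True
    thus ?thesis using assms(3) by (simp add: nth_append length_concat_uniform[OF assms(1)])
  next
    case False
    hence "n < L" using Suc.prems by simp
    moreover from this have "q * Suc n \<le> q * L" by (intro mult_le_mono2) simp
    hence "q * n + k < q * L" using assms(3) by simp
    ultimately show ?thesis
      using Suc.IH by (simp add: nth_append length_concat_uniform[OF assms(1)])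
  qed
qed simp

lemma flat_smap_fromN_snth:
  assumes "\<And>i. a \<le> i \<Longrightarrow> f i \<noteq> []" "t < length (f (a + b))"
  shows "flat (smap f (fromN a)) !! ((\<Sum>i\<in>{a..<a + b}. length (f i)) + t) = f (a + b) ! t"
  using assms
proof (induction b arbitrary: a)
  case 0
  have "flat (smap f (fromN a)) = f a @- flat (smap f (fromN (Suc a)))"
    using 0(1)[of a] by (subst flat_unfold) simp_all
  thus ?case using 0 by simp
next
  case (Suc b)
  have "flat (smap f (fromN a)) = f a @- flat (smap f (fromN (Suc a)))"
    using Suc.prems(1)[of a] by (subst flat_unfold) simp_all
  moreover have "(\<Sum>i\<in>{a..<a + Suc b}. length (f i)) =
      length (f a) + (\<Sum>i\<in>{Suc a..<Suc a + b}. length (f i))"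
    by (subst sum.atLeast_Suc_lessThan) simp_all
  moreover have "flat (smap f (fromN (Suc a))) !! ((\<Sum>i\<in>{Suc a..<Suc a + b}. length (f i)) + t) =
      f (Suc a + b) ! t"
    by (rule Suc.IH) (use Suc.prems in auto)
  ultimately show ?case by (simp add: add.assoc)
qed

definition levin_start :: "nat \<Rightarrow> nat \<Rightarrow> nat" where
  "levin_start p m = (\<Sum>i\<in>{1..<m}. p ^ i * p ^ (p ^ i))"

lemma length_levin_word: "length (levin_word p m) = p ^ m * p ^ (p ^ m)"
  unfolding levin_word_def by (rule length_concat_uniform) (simp add: levin_block_def)

lemma levin_sequence_snth:
  assumes "0 < p" "1 \<le> m" "n < p ^ (p ^ m)" "k < p ^ m"
  shows "levin_sequence p !! (levin_start p m + p ^ m * n + k) = levin_digit p m n k"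
proof -
  have "p ^ m * Suc n \<le> p ^ m * p ^ (p ^ m)" using assms(3) by (intro mult_le_mono2) simp
  hence t: "p ^ m * n + k < p ^ m * p ^ (p ^ m)" using assms(4) by simp
  have ne: "levin_word p i \<noteq> []" for i
    using length_levin_word[of p i] assms(1) by auto
  have "levin_sequence p !! ((\<Sum>i\<in>{1..<1 + (m - 1)}. length (levin_word p i)) + (p ^ m * n + k)) =
      levin_word p (1 + (m - 1)) ! (p ^ m * n + k)"
    unfolding levin_sequence_def
    by (rule flat_smap_fromN_snth) (use ne t assms(2) in \<open>auto simp: length_levin_word\<close>)
  hence "levin_sequence p !! (levin_start p m + p ^ m * n + k) = levin_word p m ! (p ^ m * n + k)"
    using assms(2) by (simp add: levin_start_def length_levin_word add.assoc)
  also have "\<dots> = levin_block p m n ! k"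
    unfolding levin_word_def
    by (rule nth_concat_uniform) (use assms in \<open>auto simp: levin_block_def\<close>)
  also have "\<dots> = levin_digit p m n k" using assms(4) by (simp add: levin_block_def)
  finally show ?thesis .
qed

lemma levin_sequence_snth_running:
  assumes "0 < p" "1 \<le> m" "Suc n < p ^ (p ^ m)" "i < 2 * p ^ m"
  shows "levin_sequence p !! (levin_start p m + p ^ m * n + i) = running_digit p m n i"
proof (cases "i < p ^ m")
  case True
  thus ?thesis using levin_sequence_snth[of p m n i] assms by (simp add: running_digit_def)
next
  case False
  define l where "l = i - p ^ m"
  have i: "i = p ^ m + l" and l: "l < p ^ m" using False assms(4) by (auto simp: l_def)
  have "levin_sequence p !! (levin_start p m + p ^ m * Suc n + l) = levin_digit p m (Suc n) l"
    by (rule levin_sequence_snth[OF assms(1-3) l])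
  thus ?thesis using l by (simp add: running_digit_def i algebra_simps)
qed

section \<open>The star discrepancy and the test interval\<close>

lemma le_star_discrepancy:
  assumes "0 < N" "0 < c" "c \<le> 1"
  shows "\<bar>real (card {n. n < N \<and> x n \<in> {0..<c}}) - c * real N\<bar> \<le> real N * star_discrepancy x N"
proof -
  let ?D = "\<lambda>c. \<bar>real (card {n. n < N \<and> x n \<in> {0..<c}}) / real N - c\<bar>"
  \<comment> \<open>A crude bound, which ensures that the supremum dominates its members.\<close>
  have "?D d \<le> 2" if "d \<in> {0<..1}" for d
  proof -
    have "card {n. n < N \<and> x n \<in> {0..<d}} \<le> card {..<N}" by (intro card_mono) auto
    hence "real (card {n. n < N \<and> x n \<in> {0..<d}}) / real N \<le> 1" using assms(1) by simp
    moreover have "real (card {n. n < N \<and> x n \<in> {0..<d}}) / real N \<ge> 0" by simp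
    ultimately show ?thesis using that unfolding greaterThanAtMost_iff by linarith
  qed
  hence "bdd_above (?D ` {0<..1})" by (rule bdd_aboveI2)
  hence "?D c \<le> star_discrepancy x N"
    unfolding star_discrepancy_def using assms by (intro cSUP_upper) auto
  hence "real N * ?D c \<le> real N * star_discrepancy x N" by (intro mult_left_mono) auto
  moreover have "real N * ?D c = \<bar>real (card {n. n < N \<and> x n \<in> {0..<c}}) - c * real N\<bar>"
    using assms(1) by (simp add: abs_mult_pos' field_simps flip: abs_mult_pos')
  ultimately show ?thesis by simp
qed

text \<open>In base \<open>p\<close> this has \<open>g\<close> digits 1, at the places congruent to
  1 modulo \<open>p\<close> when counted from 0; place \<open>l\<close> has weight
  \<open>1 / p ^ Suc l\<close>, whence the exponents.\<close>

definition levin_endpoint :: "nat \<Rightarrow> nat \<Rightarrow> real" where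
  "levin_endpoint p g = (\<Sum>i<g. 1 / real p ^ (p * i + 2))"

lemma levin_endpoint_eq:
  assumes "1 < p"
  shows "levin_endpoint p g = real (digits_value p (\<lambda>l. of_bool (l mod p = 1)) (p * g)) / real p ^ (p * g)"
proof -
  have "levin_endpoint p g = (\<Sum>l<p * g. of_bool (l mod p = 1) * (1 / real p ^ Suc l))"
    unfolding levin_endpoint_def using assms by (subst sum_residue_class) simp_all
  also have "\<dots> = real (digits_value p (\<lambda>l. of_bool (l mod p = 1)) (p * g)) / real p ^ (p * g)"
    using assms by (subst digits_value_eq_sum) simp_all
  finally show ?thesis .
qed

lemma levin_endpoint_pos: "1 < p \<Longrightarrow> 0 < g \<Longrightarrow> 0 < levin_endpoint p g"
  unfolding levin_endpoint_def by (intro sum_pos) auto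

lemma levin_endpoint_le_1:
  assumes "1 < p"
  shows "levin_endpoint p g \<le> 1"
proof -
  have "digits_value p (\<lambda>l. of_bool (l mod p = 1)) (p * g) < p ^ (p * g)"
    using assms by (intro digits_value_less_power) simp
  hence "real (digits_value p (\<lambda>l. of_bool (l mod p = 1)) (p * g)) \<le> real p ^ (p * g)"
    by (metis less_imp_le of_nat_le_iff of_nat_power)
  thus ?thesis unfolding levin_endpoint_eq[OF assms] using assms by simp
qed

text \<open>At the first of the \<open>p * g\<close> leading digits where point and endpoint differ,
  the endpoint has 1 and the point 0. This place is \<open>p * i + 1\<close> for some
  \<open>i\<close>, and the digits up to it form the lowered prefix.\<close>

lemma frac_less_levin_endpoint_imp:
  assumes "1 < p" "0 \<le> \<alpha>" "frac (real p ^ t * \<alpha>) < levin_endpoint p g"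
  shows "\<exists>i<g. \<forall>l<p * i + 2. base_digit p \<alpha> (t + l) = lowered_prefix p i l"
proof -
  define b where "b = (\<lambda>l. base_digit p \<alpha> (t + l))"
  define c :: "nat \<Rightarrow> nat" where "c = (\<lambda>l. of_bool (l mod p = 1))"
  let ?h = "p * g"
  have "real p ^ ?h * frac (real p ^ t * \<alpha>) < real (digits_value p c ?h)"
    using assms(1,3) unfolding levin_endpoint_eq[OF assms(1)] c_def
    by (simp add: pos_less_divide_eq mult.commute)
  hence "\<lfloor>real p ^ ?h * frac (real p ^ t * \<alpha>)\<rfloor> < int (digits_value p c ?h)"
    by (simp add: floor_less_iff)
  hence "digits_value p b ?h < digits_value p c ?h"
    using assms(1,2) by (simp add: floor_power_mult_frac b_def)
  moreover have "b i < p" "c i < p" for i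
    using assms(1) by (simp_all add: b_def c_def base_digit_def)
  ultimately obtain l where l: "l < ?h" "b l < c l" "\<forall>i<l. b i = c i"
    using digits_value_less_imp[of b p c ?h] by blast
  define i where "i = l div p"
  have "l mod p = 1" "b l = 0" using l(2) by (cases "l mod p = 1"; simp add: c_def)+
  hence li: "l = p * i + 1" using mult_div_mod_eq[of p l] by (simp add: i_def)
  have "i < g" using l(1) by (simp add: i_def less_mult_imp_div_less mult.commute)
  moreover have "b j = lowered_prefix p i j" if "j < p * i + 2" for j
  proof (cases "j = l")
    case True
    thus ?thesis using \<open>b l = 0\<close> li by (simp add: lowered_prefix_def)
  next
    case False
    thus ?thesis using that l(3) li by (simp add: lowered_prefix_def c_def)
  qed
  ultimately show ?thesis unfolding b_def by blast
qed

lemma card_Collect_less_diff: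
  fixes N1 N2 :: nat
  assumes "N1 \<le> N2"
  shows "card {n. n < N2 \<and> P n} = card {n. n < N1 \<and> P n} + card {n. N1 \<le> n \<and> n < N2 \<and> P n}"
proof -
  have "{n. n < N2 \<and> P n} = {n. n < N1 \<and> P n} \<union> {n. N1 \<le> n \<and> n < N2 \<and> P n}"
    using assms by auto
  moreover have "card \<dots> = card {n. n < N1 \<and> P n} + card {n. N1 \<le> n \<and> n < N2 \<and> P n}"
    by (rule card_Un_disjoint) auto
  ultimately show ?thesis by simp
qed

text \<open>Put \<open>q = p ^ m\<close>. For each of the \<open>g = q / p ^ 6\<close> prefixes,
  most of the \<open>q\<close> offsets give a deficit \<open>1 / p ^ 2\<close> and the remaining
  ones an excess of at most 1. Half of \<open>q / p ^ 2\<close> survives for each prefix, in total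
  \<open>q ^ 2 / (2 * p ^ 8)\<close>.\<close>

lemma window_deviation:
  assumes "prime p" "0 \<le> \<alpha>" "\<And>i. base_digit p \<alpha> i = levin_sequence p !! i" "6 \<le> m"
  defines "c \<equiv> levin_endpoint p (p ^ (m - 6))"
    and "N1 \<equiv> levin_start p m" and "N2 \<equiv> levin_start p m + p ^ m * levin_cut p m"
  shows "(real (card {t. t < N2 \<and> frac (real p ^ t * \<alpha>) \<in> {0..<c}}) - c * real N2) -
         (real (card {t. t < N1 \<and> frac (real p ^ t * \<alpha>) \<in> {0..<c}}) - c * real N1)
         \<le> - ((real p ^ m)\<^sup>2 / (2 * real p ^ 8))"
proof -
  define q g h M where "q = p ^ m" and "g = p ^ (m - 6)" and "h = p * g" and "M = levin_cut p m"
  have p: "1 < p" using assms(1) by (rule prime_gt_1_nat)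
  obtain m' where m': "m = Suc m'" using assms(4) by (cases m) auto
  have q_eq: "q = p ^ 5 * h"
  proof -
    have "m = 5 + Suc (m - 6)" using assms(4) by simp
    thus ?thesis unfolding q_def h_def g_def by (metis power_add power_Suc)
  qed
  have g: "1 \<le> g" "p \<le> h" using p by (simp_all add: g_def h_def)
  \<comment> \<open>Each of the last \<open>p + h\<close> offsets forfeits the deficit
    \<open>1 / p ^ 2\<close> and may add 1. The choice \<open>h = q / p ^ 5\<close> keeps this loss
    below half of the main term even for \<open>p = 2\<close>.\<close>
  have small: "real (p + h) * (real p ^ 2 + 1) \<le> real q / 2"
  proof -
    have p2: "2 \<le> real p" using p by linarith
    have "8 \<le> real p ^ 3" using power_mono[OF p2, of 3] by simp
    hence "8 * real p ^ 2 \<le> real p ^ 3 * real p ^ 2" by (intro mult_right_mono) simp_all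
    moreover have "1 \<le> real p ^ 2" using p by simp
    ultimately have "4 * (real p ^ 2 + 1) \<le> real p ^ 5" by (simp add: power_add[symmetric])
    hence "4 * (real p ^ 2 + 1) * real h \<le> real p ^ 5 * real h" by (intro mult_right_mono) simp_all
    moreover have "real (p + h) * (real p ^ 2 + 1) \<le> 2 * real h * (real p ^ 2 + 1)"
      using g(2) by (intro mult_right_mono) simp_all
    ultimately have "4 * (real (p + h) * (real p ^ 2 + 1)) \<le> 2 * (real p ^ 5 * real h)"
      by (simp add: algebra_simps)
    thus ?thesis by (simp add: q_eq mult.commute)
  qed
  have hq: "p + h \<le> q"
  proof -
    have "real (p + h) * 1 \<le> real (p + h) * (real p ^ 2 + 1)" by (intro mult_left_mono) simp_all
    hence "real (p + h) \<le> real q" using small by simp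
    thus ?thesis by simp
  qed
  have s_le: "p * i + 2 \<le> h" if "i < g" for i
  proof -
    have "p * Suc i \<le> h" unfolding h_def using that by (intro mult_le_mono2) simp
    thus ?thesis using p by simp
  qed
  define A where
    "A i k = {n. n < M \<and> (\<forall>l<p * i + 2. running_digit p m n (k + l) = lowered_prefix p i l)}" for i k
  have A_good: "real (card (A i k)) \<le> real M / real p ^ (p * i + 2) - 1 / real p ^ 2"
    if "i < g" "k < q - (p + h)" for i k
  proof -
    have "k + (p * i + 2) + p \<le> p ^ Suc m'" using s_le[OF that(1)] that(2) by (simp add: q_def m')
    hence "card (A i k) \<le> M div p ^ (p * i + 2)"
      unfolding A_def M_def m' by (rule card_window_cut_le[OF assms(1)])
    hence "real (card (A i k)) \<le> real (M div p ^ (p * i + 2))" by (simp only: of_nat_le_iff)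
    also have "\<dots> \<le> real M / real p ^ (p * i + 2) - 1 / real p ^ 2"
      unfolding M_def by (rule cut_div_le[OF p]) (use s_le[OF that(1)] hq q_def in linarith)
    finally show ?thesis .
  qed
  have A_bad: "real (card (A i k)) \<le> real M / real p ^ (p * i + 2) + 1" if "i < g" "k < q" for i k
  proof -
    have "card (A i k) \<le> M div p ^ (p * i + 2) + 1"
      unfolding A_def by (rule card_window_le[OF assms(1)]) (use s_le[OF that(1)] that(2) hq q_def in linarith)+
    hence "real (card (A i k)) \<le> real (M div p ^ (p * i + 2)) + 1" by linarith
    also have "real (M div p ^ (p * i + 2)) \<le> real M / real p ^ (p * i + 2)"
      using of_nat_div_le_of_nat[of M "p ^ (p * i + 2)", where 'a = real] by simp
    finally show ?thesis by simp
  qed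
  have A_sum: "(\<Sum>k<q. real (card (A i k))) \<le> real q * (real M / real p ^ (p * i + 2)) - real q / (2 * real p ^ 2)"
    if "i < g" for i
  proof -
    define r a where "r = real M / real p ^ (p * i + 2)" and "a = q - (p + h)"
    have a: "real a = real q - real (p + h)" "real (q - a) = real (p + h)"
      using hq by (simp_all add: a_def of_nat_diff)
    have "(\<Sum>k<q. real (card (A i k))) =
        (\<Sum>k<a. real (card (A i k))) + (\<Sum>k\<in>{a..<q}. real (card (A i k)))"
      by (subst sum.union_disjoint[symmetric]) (auto simp: a_def intro: sum.cong)
    also have "\<dots> \<le> (\<Sum>k<a. r - 1 / real p ^ 2) + (\<Sum>k\<in>{a..<q}. r + 1)"
      using A_good[OF that] A_bad[OF that]
      by (intro add_mono sum_mono) (auto simp: a_def r_def)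
    also have "\<dots> = real q * r - (real q - real (p + h)) / real p ^ 2 + real (p + h)"
      by (simp add: a ring_distribs diff_divide_distrib del: of_nat_add)
    also have "\<dots> = real q * r - real q / real p ^ 2 + real (p + h) * (real p ^ 2 + 1) / real p ^ 2"
      using p by (simp add: field_simps)
    also have "\<dots> \<le> real q * r - real q / real p ^ 2 + (real q / 2) / real p ^ 2"
      using small by (intro add_left_mono divide_right_mono) simp_all
    also have "\<dots> = real q * r - real q / (2 * real p ^ 2)" using p by (simp add: field_simps)
    finally show ?thesis unfolding r_def .
  qed
  let ?P = "\<lambda>t. frac (real p ^ t * \<alpha>) \<in> {0..<c}"
  \<comment> \<open>A position is split into block index \<open>n\<close> and offset
    \<open>k\<close>. An inclusion suffices, as the count is only bounded from above.\<close>
  have "{t. N1 \<le> t \<and> t < N2 \<and> ?P t} \<subseteq> (\<Union>i<g. \<Union>k<q. (\<lambda>n. N1 + q * n + k) ` A i k)"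
  proof
    fix t assume t: "t \<in> {t. N1 \<le> t \<and> t < N2 \<and> ?P t}"
    define n k where "n = (t - N1) div q" and "k = (t - N1) mod q"
    have q0: "q > 0" using p by (simp add: q_def)
    have t_eq: "t = N1 + q * n + k" using t by (simp add: n_def k_def)
    have k: "k < q" using q0 by (simp add: k_def)
    have "t - N1 < M * q" using t unfolding N1_def N2_def M_def q_def by (auto simp: mult.commute)
    hence n: "n < M" unfolding n_def by (rule less_mult_imp_div_less)
    obtain i where i: "i < g" "\<forall>l<p * i + 2. base_digit p \<alpha> (t + l) = lowered_prefix p i l"
      using frac_less_levin_endpoint_imp[OF p assms(2), of t g] t unfolding c_def g_def by auto
    have "running_digit p m n (k + l) = lowered_prefix p i l" if "l < p * i + 2" for l
    proof -
      have "levin_sequence p !! (N1 + q * n + (k + l)) = running_digit p m n (k + l)"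
        unfolding N1_def q_def
      proof (rule levin_sequence_snth_running)
        \<comment> \<open>As \<open>Suc n \<le> M\<close>, the following block still belongs to the
          same word.\<close>
        show "Suc n < p ^ p ^ m" using n cut_less[OF p, of m] unfolding M_def by linarith
        show "k + l < 2 * p ^ m" using k that s_le[OF i(1)] hq unfolding q_def by linarith
      qed (use p assms(4) in auto)
      thus ?thesis using i(2) that assms(3) by (simp add: t_eq add.assoc)
    qed
    hence "n \<in> A i k" using n by (simp add: A_def)
    thus "t \<in> (\<Union>i<g. \<Union>k<q. (\<lambda>n. N1 + q * n + k) ` A i k)" using i(1) k t_eq by blast
  qed
  hence "card {t. N1 \<le> t \<and> t < N2 \<and> ?P t} \<le> card (\<Union>i<g. \<Union>k<q. (\<lambda>n. N1 + q * n + k) ` A i k)"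
    by (intro card_mono) (auto simp: A_def)
  also have "\<dots> \<le> (\<Sum>i<g. card (\<Union>k<q. (\<lambda>n. N1 + q * n + k) ` A i k))"
    by (rule card_UN_le) simp
  also have "\<dots> \<le> (\<Sum>i<g. \<Sum>k<q. card (A i k))"
    by (intro sum_mono order.trans[OF card_UN_le] card_image_le) (simp_all add: A_def)
  finally have "real (card {t. N1 \<le> t \<and> t < N2 \<and> ?P t}) \<le> real (\<Sum>i<g. \<Sum>k<q. card (A i k))"
    by (simp only: of_nat_le_iff)
  also have "\<dots> = (\<Sum>i<g. \<Sum>k<q. real (card (A i k)))" by simp
  also have "\<dots> \<le> (\<Sum>i<g. real q * (real M / real p ^ (p * i + 2)) - real q / (2 * real p ^ 2))"
    by (intro sum_mono A_sum) simp
  also have "\<dots> = c * real (q * M) - real g * (real q / (2 * real p ^ 2))"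
    by (simp add: c_def levin_endpoint_def g_def sum_subtractf sum_distrib_left sum_distrib_right mult_ac)
  also have "real g * (real q / (2 * real p ^ 2)) = (real p ^ m)\<^sup>2 / (2 * real p ^ 8)"
  proof -
    have "real p ^ m = real p ^ 6 * real g"
      using power_add[of "real p" 6 "m - 6"] assms(4) by (simp add: g_def)
    hence "real q = real p ^ 6 * real g" "(real p ^ m)\<^sup>2 = real p ^ 6 * real g * (real p ^ 6 * real g)"
      by (simp_all add: q_def power2_eq_square)
    moreover have "real p ^ 8 = real p ^ 6 * (real p)\<^sup>2"
      using power_add[of "real p" 6 2] by simp
    moreover have "real p ^ 6 \<noteq> 0" "(real p)\<^sup>2 \<noteq> 0" using p by simp_all
    ultimately show ?thesis by (simp only:) (simp add: divide_simps)
  qed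
  finally have "real (card {t. N1 \<le> t \<and> t < N2 \<and> ?P t}) \<le> c * real (q * M) - (real p ^ m)\<^sup>2 / (2 * real p ^ 8)" .
  moreover have "card {t. t < N2 \<and> ?P t} = card {t. t < N1 \<and> ?P t} + card {t. N1 \<le> t \<and> t < N2 \<and> ?P t}"
    by (rule card_Collect_less_diff) (simp add: N1_def N2_def)
  moreover have "real N2 = real N1 + real (q * M)" by (simp add: N1_def N2_def q_def M_def)
  ultimately show ?thesis by (simp add: algebra_simps)
qed

section \<open>Size of the two endpoints and conclusion\<close>

lemma le_levin_start: "0 < p \<Longrightarrow> m \<le> Suc (levin_start p m)"
proof -
  assume "0 < p"
  hence "(\<Sum>i\<in>{1..<m}. 1) \<le> levin_start p m"
    unfolding levin_start_def by (intro sum_mono) (simp add: Suc_le_eq)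
  thus ?thesis by simp
qed

text \<open>With \<open>q = p ^ m\<close>, there are at most \<open>Suc m \<le> p ^ q\<close> words
  of length at most \<open>q * p ^ q \<le> p ^ q * p ^ q\<close>. This yields
  \<open>ln N \<le> 3 * q * ln p\<close> for both endpoints.\<close>

lemma levin_start_Suc_le:
  assumes "1 < p"
  shows "levin_start p m + p ^ m * p ^ (p ^ m) \<le> p ^ (3 * p ^ m)"
proof -
  let ?q = "p ^ m"
  have lt: "n < p ^ n" for n using assms by (intro power_gt_expt) simp
  have "levin_start p m + ?q * p ^ ?q \<le> (\<Sum>i\<in>{0..<Suc m}. p ^ i * p ^ (p ^ i))"
    unfolding levin_start_def by (simp, rule sum_mono2) auto
  also have "\<dots> \<le> (\<Sum>i\<in>{0..<Suc m}. ?q * p ^ ?q)"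
    using assms by (intro sum_mono mult_le_mono power_increasing) auto
  also have "\<dots> = Suc m * (?q * p ^ ?q)" by simp
  also have "\<dots> \<le> p ^ ?q * (p ^ ?q * p ^ ?q)"
    using lt[of m] lt[of ?q] by (intro mult_le_mono) simp_all
  also have "\<dots> = p ^ (?q + (?q + ?q))" by (simp only: power_add)
  also have "?q + (?q + ?q) = 3 * ?q" by simp
  finally show ?thesis .
qed

text \<open>The errors at the two endpoints differ by at least \<open>q ^ 2 / (2 * p ^ 8)\<close>,
  where \<open>q = p ^ m\<close>, so one has absolute value at least half of this. Dividing by the
  bound \<open>9 * q ^ 2 * (ln p) ^ 2\<close> for the squared logarithm produces the factor
  36.\<close>

lemma exists_large_discrepancy:
  assumes "prime p" "0 \<le> \<alpha>" "\<And>i. base_digit p \<alpha> i = levin_sequence p !! i" "6 \<le> m"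
  shows "\<exists>N\<ge>m - 1. real N * star_discrepancy (\<lambda>n. frac (real p ^ n * \<alpha>)) N
           \<ge> 1 / (36 * real p ^ 8 * (ln (real p))\<^sup>2) * (ln (real N))\<^sup>2"
proof -
  define c N1 N2 where "c = levin_endpoint p (p ^ (m - 6))"
    and "N1 = levin_start p m" and "N2 = levin_start p m + p ^ m * levin_cut p m"
  define E where "E N = real (card {t. t < N \<and> frac (real p ^ t * \<alpha>) \<in> {0..<c}}) - c * real N" for N
  let ?q = "real p ^ m"
  have p: "1 < p" using assms(1) by (rule prime_gt_1_nat)
  have "E N2 - E N1 \<le> - (?q\<^sup>2 / (2 * real p ^ 8))"
    unfolding E_def c_def N1_def N2_def by (rule window_deviation[OF assms])
  moreover have "?q\<^sup>2 / (2 * real p ^ 8) = 2 * (?q\<^sup>2 / (4 * real p ^ 8))" by simp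
  ultimately have "?q\<^sup>2 / (4 * real p ^ 8) \<le> \<bar>E N1\<bar> \<or> ?q\<^sup>2 / (4 * real p ^ 8) \<le> \<bar>E N2\<bar>"
    by linarith
  then obtain N where N: "N = N1 \<or> N = N2" "?q\<^sup>2 / (4 * real p ^ 8) \<le> \<bar>E N\<bar>" by blast
  have N_ge: "m - 1 \<le> N"
    using le_levin_start[of p m] p N(1) unfolding N1_def N2_def by auto
  hence N0: "0 < N" using assms(4) by simp
  have "p ^ m * levin_cut p m \<le> p ^ m * p ^ (p ^ m)"
    using cut_less[OF p, of m] by (intro mult_le_mono2) simp
  hence "N \<le> p ^ (3 * p ^ m)"
    using levin_start_Suc_le[OF p, of m] N(1) unfolding N1_def N2_def by linarith
  hence "real N \<le> real p ^ (3 * p ^ m)" by (metis of_nat_le_iff of_nat_power)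
  hence "ln (real N) \<le> ln (real p ^ (3 * p ^ m))" using N0 p by (subst ln_le_cancel_iff) auto
  also have "\<dots> = 3 * ?q * ln (real p)" using p by (simp add: ln_realpow)
  finally have "(ln (real N))\<^sup>2 \<le> (3 * ?q * ln (real p))\<^sup>2"
    using N0 by (intro power_mono) auto
  moreover have lnp: "ln (real p) > 0" using p by simp
  ultimately have "1 / (36 * real p ^ 8 * (ln (real p))\<^sup>2) * (ln (real N))\<^sup>2 \<le>
      1 / (36 * real p ^ 8 * (ln (real p))\<^sup>2) * (3 * ?q * ln (real p))\<^sup>2"
    by (intro mult_left_mono) simp_all
  also have "\<dots> = ?q\<^sup>2 / (4 * real p ^ 8)"
    using lnp p by (simp add: power_mult_distrib field_simps)
  also note N(2)
  also have "\<bar>E N\<bar> \<le> real N * star_discrepancy (\<lambda>n. frac (real p ^ n * \<alpha>)) N"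
    unfolding E_def using p
    by (intro le_star_discrepancy N0) (simp_all add: c_def levin_endpoint_pos levin_endpoint_le_1)
  finally show ?thesis using N_ge by blast
qed

theorem theorem2:
  fixes p :: nat
  assumes "prime p"
  shows "\<exists>c::real. c > 0 \<and>
    (\<forall>\<alpha>::real. 0 \<le> \<alpha> \<longrightarrow> \<alpha> < 1 \<longrightarrow>
       (\<forall>i. base_digit p \<alpha> i = levin_sequence p !! i) \<longrightarrow>
       infinite {N::nat. real N * star_discrepancy (\<lambda>n. frac (real p ^ n * \<alpha>)) N
                           \<ge> c * (ln (real N))\<^sup>2})"
proof (intro exI conjI allI impI)
  have p: "1 < p" using assms by (rule prime_gt_1_nat)
  show "0 < 1 / (36 * real p ^ 8 * (ln (real p))\<^sup>2)" using p by simp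
  fix \<alpha> :: real
  assume \<alpha>: "0 \<le> \<alpha>" "\<forall>i. base_digit p \<alpha> i = levin_sequence p !! i"
  show "infinite {N::nat. real N * star_discrepancy (\<lambda>n. frac (real p ^ n * \<alpha>)) N
          \<ge> 1 / (36 * real p ^ 8 * (ln (real p))\<^sup>2) * (ln (real N))\<^sup>2}"
    unfolding infinite_nat_iff_unbounded_le
  proof
    fix B
    \<comment> \<open>The word index \<open>B + 6\<close> satisfies the lower bound 6 and places
      \<open>N\<close> beyond \<open>B\<close>.\<close>
    obtain N where "B + 6 - 1 \<le> N"
      "real N * star_discrepancy (\<lambda>n. frac (real p ^ n * \<alpha>)) N
         \<ge> 1 / (36 * real p ^ 8 * (ln (real p))\<^sup>2) * (ln (real N))\<^sup>2"
      using exists_large_discrepancy[OF assms \<alpha>(1), of "B + 6"] \<alpha>(2) by auto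
    thus "\<exists>N\<ge>B. N \<in> {N. real N * star_discrepancy (\<lambda>n. frac (real p ^ n * \<alpha>)) N
        \<ge> 1 / (36 * real p ^ 8 * (ln (real p))\<^sup>2) * (ln (real N))\<^sup>2}"
      by (intro exI[of _ N]) simp
  qed
qed

end
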